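(* Let $X$ be an almost surely bounded, non-degenerate real random variable that is symmetric with respect to its mean $\mu=\mathbb{E}[X]$. If $$\frac{\mathbb{E}[(X-\mu)^{2j}]}{(2j)!}\le\frac{(\mathbb{V}[X])^j}{2^j\,j!}\quad\text{for all integers } j\ge2,$$ then $X$ is strictly sub-Gaussian.
   Context: A random variable $X$ with finite mean $\mu$ is $\sigma^2$-sub-Gaussian, with proxy variance $\sigma^2>0$, if $\mathbb{E}[\exp(\lambda(X-\mu))]\le \exp(\lambda^2\sigma^2/2)$ for all $\lambda\in\mathbb{R}$. The smallest such $\sigma^2$ is the optimal proxy variance $\sigma_{\mathrm{opt}}^2(X)$. One says that $X$ is strictly sub-Gaussian if $\sigma_{\mathrm{opt}}^2(X)=\mathbb{V}[X]$, where $\mathbb{V}[X]$ is the variance of $X$. Symmetric with respect to $\mu$ means that $X$ and $2\mu-X$ have the same distribution. Non-degenerate means not almost surely constant. *)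

theory Defs
  imports "HOL-Probability.Probability"
begin

(* Integrability of the exponentials is required explicitly: the Bochner integral of a
   non-integrable function is 0, so the bare inequality would hold if the moment
   generating function were infinite. *)
definition sub_gaussian :: "'a measure \<Rightarrow> ('a \<Rightarrow> real) \<Rightarrow> real \<Rightarrow> bool" where
  "sub_gaussian M X s \<longleftrightarrow> s > 0 \<and> integrable M X \<and>
     (\<forall>l::real. integrable M (\<lambda>\<omega>. exp (l * (X \<omega> - prob_space.expectation M X))) \<and>
        prob_space.expectation M (\<lambda>\<omega>. exp (l * (X \<omega> - prob_space.expectation M X)))
          \<le> exp (l\<^sup>2 * s / 2))"

definition optimal_proxy_variance :: "'a measure \<Rightarrow> ('a \<Rightarrow> real) \<Rightarrow> real" where
  "optimal_proxy_variance M X = (LEAST s. sub_gaussian M X s)"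

(* The first conjunct rules out the cases in which the LEAST above is unspecified: X not
   sub-Gaussian, or X almost surely constant (every s > 0 is then a proxy variance, but
   the variance is 0, which is not). *)
definition strictly_sub_gaussian :: "'a measure \<Rightarrow> ('a \<Rightarrow> real) \<Rightarrow> bool" where
  "strictly_sub_gaussian M X \<longleftrightarrow>
     sub_gaussian M X (optimal_proxy_variance M X) \<and>
     optimal_proxy_variance M X = prob_space.variance M X"

definition symmetric_about_mean :: "'a measure \<Rightarrow> ('a \<Rightarrow> real) \<Rightarrow> bool" where
  "symmetric_about_mean M X \<longleftrightarrow>
     distr M borel X = distr M borel (\<lambda>\<omega>. 2 * prob_space.expectation M X - X \<omega>)"

end

theory Submission
  imports Defs
begin

text \<open>
  Write \<open>Y = X - \<mu>\<close> and \<open>V\<close> for the variance. The hypothesis on the moments is exactly a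
  coefficientwise comparison of two power series in \<open>\<lambda>\<close>. Since \<open>Y\<close> is bounded, its moment
  generating function is the sum of its moment series (\<open>moment_series_bounded\<close>), and symmetry
  kills the odd terms (\<open>odd_central_moment_eq_0\<close>), so
  \<open>E[exp (\<lambda> Y)] = \<Sum>j. \<lambda>\<^sup>2\<^sup>j E[Y\<^sup>2\<^sup>j] / (2 j)!\<close>, while \<open>exp (\<lambda>\<^sup>2 V / 2) = \<Sum>j. \<lambda>\<^sup>2\<^sup>j V\<^sup>j / (2\<^sup>j j!)\<close>.
  The terms for \<open>j = 0\<close> and \<open>j = 1\<close> agree, and the hypothesis bounds all later ones. Hence \<open>V\<close> is
  a proxy variance; it is positive because \<open>X\<close> is not almost surely constant.

  That no smaller proxy variance exists is true of every law with a finite variance: at \<open>\<lambda> = 0\<close> the moment generating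
  function and its Gaussian bound agree to first order, and the second-order terms compare the
  variance with the proxy variance (\<open>variance_le_proxy_variance\<close>).
\<close>

lemma exp_series_sums: "(\<lambda>n. x ^ n / fact n) sums exp (x::real)"
  using exp_converges[of x] by (simp add: divide_inverse mult.commute)

lemma cosh_ge_quadratic: "1 + x\<^sup>2 / 2 \<le> cosh (x::real)"
proof -
  have "(\<Sum>n<3. if even n then x ^ n /\<^sub>R fact n else 0) \<le> cosh x"
    using sum_le_suminf[of "\<lambda>n. if even n then x ^ n /\<^sub>R fact n else 0" "{..<3}"]
      cosh_converges[of x]
    by (auto simp: sums_iff zero_le_even_power)
  then show ?thesis
    by (simp add: eval_nat_numeral field_simps)
qed

text \<open>
  Averaging the sub-Gaussian bound over \<open>\<lambda>\<close> and \<open>-\<lambda>\<close> removes the linear term, and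
  \<open>cosh y \<ge> 1 + y\<^sup>2 / 2\<close> then gives \<open>1 + t V \<le> exp (t s)\<close> for \<open>t = \<lambda>\<^sup>2 / 2\<close>. Letting \<open>t\<close> tend to
  \<open>0\<close> compares the slopes at \<open>0\<close>.
\<close>

lemma variance_le_proxy_variance:
  assumes "prob_space M" and sg: "sub_gaussian M X s"
    and sq: "integrable M (\<lambda>\<omega>. (X \<omega> - prob_space.expectation M X)\<^sup>2)"
  shows "prob_space.variance M X \<le> s"
proof -
  interpret prob_space M by fact
  let ?Y = "\<lambda>\<omega>. X \<omega> - expectation X"
  let ?V = "variance X"
  have s: "s > 0"
    and int: "\<And>l. integrable M (\<lambda>\<omega>. exp (l * ?Y \<omega>))"
    and mgf: "\<And>l. expectation (\<lambda>\<omega>. exp (l * ?Y \<omega>)) \<le> exp (l\<^sup>2 * s / 2)"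
    using sg by (auto simp: sub_gaussian_def)
  have quad: "1 + l\<^sup>2 * ?V / 2 \<le> exp (l\<^sup>2 * s / 2)" for l :: real
  proof -
    have "1 + l\<^sup>2 * ?V / 2 = expectation (\<lambda>\<omega>. 1 + l\<^sup>2 / 2 * (?Y \<omega>)\<^sup>2)"
      using sq by (simp add: prob_space)
    also have "\<dots> \<le> expectation (\<lambda>\<omega>. (exp (l * ?Y \<omega>) + exp (- l * ?Y \<omega>)) / 2)"
    proof (rule integral_mono)
      show "integrable M (\<lambda>\<omega>. 1 + l\<^sup>2 / 2 * (?Y \<omega>)\<^sup>2)"
        using sq by simp
      show "integrable M (\<lambda>\<omega>. (exp (l * ?Y \<omega>) + exp (- l * ?Y \<omega>)) / 2)"
        using int[of l] int[of "- l"] by (intro integrable_divide_zero Bochner_Integration.integrable_add)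
      show "1 + l\<^sup>2 / 2 * (?Y \<omega>)\<^sup>2 \<le> (exp (l * ?Y \<omega>) + exp (- l * ?Y \<omega>)) / 2" for \<omega>
        using cosh_ge_quadratic[of "l * ?Y \<omega>"] by (simp add: cosh_field_def power_mult_distrib)
    qed
    also have "\<dots> = (expectation (\<lambda>\<omega>. exp (l * ?Y \<omega>)) + expectation (\<lambda>\<omega>. exp (- l * ?Y \<omega>))) / 2"
      using int[of l] int[of "- l"] by (subst integral_divide_zero, subst Bochner_Integration.integral_add) auto
    also have "\<dots> \<le> exp (l\<^sup>2 * s / 2)"
      using mgf[of l] mgf[of "- l"] by simp
    finally show ?thesis .
  qed
  show ?thesis
  proof (rule field_le_epsilon)
    fix e :: real assume e: "e > 0"
    \<comment> \<open>The remainder of the exponential is at most \<open>(t * s)\<^sup>2\<close> as long as \<open>t * s \<le> 1\<close>; the second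
      bound on \<open>t\<close> turns this into \<open>t * e\<close>.\<close>
    define t where "t = min (1 / s) (e / s\<^sup>2)"
    have t: "t > 0" "t * s \<le> 1" "t * s\<^sup>2 \<le> e"
      using s e by (auto simp: t_def min_def field_simps split: if_splits)
    have "1 + t * ?V \<le> exp (t * s)"
      using quad[of "sqrt (2 * t)"] t(1) by (simp add: real_sqrt_pow2)
    also have "\<dots> \<le> 1 + t * s + (t * s)\<^sup>2"
      using t s by (intro exp_bound) auto
    finally have "t * ?V \<le> t * (s + t * s\<^sup>2)"
      by (simp add: algebra_simps power2_eq_square)
    then show "?V \<le> s + e"
      using t by (simp add: mult_le_cancel_left_pos)
  qed
qed

lemma (in prob_space) integrable_exp_mult_bounded:
  fixes Y :: "'a \<Rightarrow> real"
  assumes [measurable]: "Y \<in> borel_measurable M" and bd: "AE \<omega> in M. \<bar>Y \<omega>\<bar> \<le> B"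
  shows "integrable M (\<lambda>\<omega>. exp (l * Y \<omega>))"
proof (rule integrable_const_bound)
  show "AE \<omega> in M. norm (exp (l * Y \<omega>)) \<le> exp (\<bar>l\<bar> * B)"
    using bd
  proof eventually_elim
    case (elim \<omega>)
    have "l * Y \<omega> \<le> \<bar>l\<bar> * \<bar>Y \<omega>\<bar>"
      by (metis abs_ge_self abs_mult)
    also have "\<dots> \<le> \<bar>l\<bar> * B"
      using elim by (intro mult_left_mono) auto
    finally show ?case by simp
  qed
qed simp

lemma (in prob_space) integrable_power_bounded:
  fixes Y :: "'a \<Rightarrow> real"
  assumes [measurable]: "Y \<in> borel_measurable M" and bd: "AE \<omega> in M. \<bar>Y \<omega>\<bar> \<le> B"
  shows "integrable M (\<lambda>\<omega>. Y \<omega> ^ n)"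
proof (rule integrable_const_bound)
  show "AE \<omega> in M. norm (Y \<omega> ^ n) \<le> B ^ n"
    using bd by eventually_elim (auto simp: power_abs intro: power_mono)
qed simp

text \<open>
  The exponential series may be integrated term by term because its \<open>n\<close>-th term is at most
  \<open>(\<bar>l\<bar> B)\<^sup>n / n!\<close> in absolute value almost surely, and these bounds are summable.
\<close>

lemma (in prob_space) moment_series_bounded:
  fixes Y :: "'a \<Rightarrow> real"
  assumes [measurable]: "Y \<in> borel_measurable M" and bd: "AE \<omega> in M. \<bar>Y \<omega>\<bar> \<le> B"
  shows "(\<lambda>n. l ^ n * expectation (\<lambda>\<omega>. Y \<omega> ^ n) / fact n) sums expectation (\<lambda>\<omega>. exp (l * Y \<omega>))"
proof -
  let ?f = "\<lambda>n \<omega>. (l * Y \<omega>) ^ n / fact n"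
  have int: "integrable M (?f n)" for n
    using integrable_power_bounded[OF assms] by (simp add: power_mult_distrib)
  have exp_abs: "summable (\<lambda>n. (\<bar>l\<bar> * B) ^ n / fact n)"
    using exp_series_sums by (rule sums_summable)
  have "(\<lambda>n. integral\<^sup>L M (?f n)) sums (\<integral>\<omega>. (\<Sum>n. ?f n \<omega>) \<partial>M)"
  proof (rule sums_integral)
    show "integrable M (?f n)" for n
      by (rule int)
    show "AE \<omega> in M. summable (\<lambda>n. norm (?f n \<omega>))"
      using summable_norm_exp[of "l * Y \<omega>" for \<omega>] by (simp add: divide_inverse mult.commute)
    show "summable (\<lambda>n. \<integral>\<omega>. norm (?f n \<omega>) \<partial>M)"
    proof (rule summable_comparison_test'[OF exp_abs])
      fix n :: nat
      have "(\<integral>\<omega>. norm (?f n \<omega>) \<partial>M) \<le> (\<integral>\<omega>. (\<bar>l\<bar> * B) ^ n / fact n \<partial>M)"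
      proof (rule integral_mono_AE)
        show "AE \<omega> in M. norm (?f n \<omega>) \<le> (\<bar>l\<bar> * B) ^ n / fact n"
          using bd
          by eventually_elim
            (auto simp: abs_mult power_abs intro!: divide_right_mono power_mono mult_left_mono)
      next
        show "integrable M (\<lambda>\<omega>. norm (?f n \<omega>))"
          by (rule integrable_norm[OF int])
      qed simp
      then show "norm (\<integral>\<omega>. norm (?f n \<omega>) \<partial>M) \<le> (\<bar>l\<bar> * B) ^ n / fact n"
        by (simp add: prob_space)
    qed
  qed
  moreover have "(\<Sum>n. ?f n \<omega>) = exp (l * Y \<omega>)" for \<omega>
    using exp_series_sums[of "l * Y \<omega>"] by (simp add: sums_iff)
  moreover have "integral\<^sup>L M (?f n) = l ^ n * expectation (\<lambda>\<omega>. Y \<omega> ^ n) / fact n" for n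
    by (simp add: power_mult_distrib)
  ultimately show ?thesis by simp
qed

lemma (in prob_space) odd_central_moment_eq_0:
  fixes X :: "'a \<Rightarrow> real"
  assumes [measurable]: "X \<in> borel_measurable M"
    and sym: "symmetric_about_mean M X" and "odd n"
  shows "expectation (\<lambda>\<omega>. (X \<omega> - expectation X) ^ n) = 0"
proof -
  let ?\<mu> = "expectation X"
  have "expectation (\<lambda>\<omega>. (X \<omega> - ?\<mu>) ^ n) = (\<integral>x. (x - ?\<mu>) ^ n \<partial>distr M borel X)"
    by (subst integral_distr) auto
  also have "\<dots> = (\<integral>x. (x - ?\<mu>) ^ n \<partial>distr M borel (\<lambda>\<omega>. 2 * ?\<mu> - X \<omega>))"
    using sym by (simp add: symmetric_about_mean_def)
  also have "\<dots> = expectation (\<lambda>\<omega>. (2 * ?\<mu> - X \<omega> - ?\<mu>) ^ n)"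
    by (subst integral_distr) auto
  also have "\<dots> = expectation (\<lambda>\<omega>. - ((X \<omega> - ?\<mu>) ^ n))"
  proof (rule Bochner_Integration.integral_cong[OF refl])
    show "(2 * ?\<mu> - X \<omega> - ?\<mu>) ^ n = - ((X \<omega> - ?\<mu>) ^ n)" for \<omega>
      using power_minus_odd[OF \<open>odd n\<close>, of "X \<omega> - ?\<mu>"] by simp
  qed
  finally show ?thesis by simp
qed

lemma (in prob_space) variance_pos:
  fixes X :: "'a \<Rightarrow> real"
  assumes sq: "integrable M (\<lambda>\<omega>. (X \<omega> - expectation X)\<^sup>2)"
    and "\<not> (\<exists>c. AE \<omega> in M. X \<omega> = c)"
  shows "variance X > 0"
proof -
  have "variance X \<noteq> 0"
  proof
    assume "variance X = 0"
    then have "AE \<omega> in M. (X \<omega> - expectation X)\<^sup>2 = 0"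
      using integral_nonneg_eq_0_iff_AE[OF sq] by simp
    then have "AE \<omega> in M. X \<omega> = expectation X"
      by simp
    with assms(2) show False by blast
  qed
  moreover have "variance X \<ge> 0"
    by simp
  ultimately show ?thesis by linarith
qed

theorem proposition3p3:
  fixes M :: "'a measure" and X :: "'a \<Rightarrow> real"
  assumes "prob_space M"
    and "X \<in> borel_measurable M"
    and "\<exists>C. AE \<omega> in M. \<bar>X \<omega>\<bar> \<le> C"
    and "\<not> (\<exists>c. AE \<omega> in M. X \<omega> = c)"
    and "symmetric_about_mean M X"
    and "\<And>j::nat. j \<ge> 2 \<Longrightarrow>
           prob_space.expectation M (\<lambda>\<omega>. (X \<omega> - prob_space.expectation M X) ^ (2 * j)) / fact (2 * j)
             \<le> prob_space.variance M X ^ j / (2 ^ j * fact j)"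
  shows "strictly_sub_gaussian M X"
proof -
  interpret prob_space M by fact
  note [measurable] = \<open>X \<in> borel_measurable M\<close>
  let ?Y = "\<lambda>\<omega>. X \<omega> - expectation X"
  let ?V = "variance X"
  obtain C where C: "AE \<omega> in M. \<bar>X \<omega>\<bar> \<le> C"
    using assms(3) by blast
  have bd: "AE \<omega> in M. \<bar>?Y \<omega>\<bar> \<le> C + \<bar>expectation X\<bar>"
    using C by eventually_elim linarith
  have intX: "integrable M X"
    using integrable_power_bounded[OF _ C, of 1] by simp
  have sq: "integrable M (\<lambda>\<omega>. (?Y \<omega>)\<^sup>2)"
    using integrable_power_bounded[OF _ bd] by simp
  have V: "?V > 0"
    using variance_pos[OF sq assms(4)] .
  have mgf: "expectation (\<lambda>\<omega>. exp (l * ?Y \<omega>)) \<le> exp (l\<^sup>2 * ?V / 2)" for l :: real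
  proof -
    let ?a = "\<lambda>n. l ^ n * expectation (\<lambda>\<omega>. ?Y \<omega> ^ n) / fact n"
    have "?a sums expectation (\<lambda>\<omega>. exp (l * ?Y \<omega>))"
      by (rule moment_series_bounded[OF _ bd]) simp
    moreover have "?a n = 0" if "n \<notin> range ((*) 2)" for n
    proof -
      have "odd n" using that by (auto elim!: evenE)
      then show ?thesis
        using odd_central_moment_eq_0[OF assms(2,5)] by simp
    qed
    moreover have "strict_mono ((*) (2::nat))"
      by (auto simp: strict_mono_def)
    ultimately have even_series: "(\<lambda>j. ?a (2 * j)) sums expectation (\<lambda>\<omega>. exp (l * ?Y \<omega>))"
      by (subst sums_mono_reindex) auto
    have gauss_series: "(\<lambda>j. (l\<^sup>2 * ?V / 2) ^ j / fact j) sums exp (l\<^sup>2 * ?V / 2)"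
      by (rule exp_series_sums)
    have "?a (2 * j) \<le> (l\<^sup>2 * ?V / 2) ^ j / fact j" for j
    proof -
      have "expectation (\<lambda>\<omega>. ?Y \<omega> ^ (2 * j)) / fact (2 * j) \<le> ?V ^ j / (2 ^ j * fact j)"
      proof (cases "j \<ge> 2")
        case True
        then show ?thesis by (rule assms(6))
      next
        case False
        then have "j = 0 \<or> j = 1" by linarith
        then show ?thesis by (auto simp: prob_space)
      qed
      then have "(l\<^sup>2) ^ j * (expectation (\<lambda>\<omega>. ?Y \<omega> ^ (2 * j)) / fact (2 * j))
          \<le> (l\<^sup>2) ^ j * (?V ^ j / (2 ^ j * fact j))"
        by (intro mult_left_mono) auto
      then show ?thesis
        by (simp add: power_mult power_mult_distrib power_divide)
    qed
    then show ?thesis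
      using even_series gauss_series by (rule sums_le)
  qed
  have sg: "sub_gaussian M X ?V"
    unfolding sub_gaussian_def
    using V intX mgf integrable_exp_mult_bounded[OF _ bd] by auto
  have "optimal_proxy_variance M X = ?V"
    unfolding optimal_proxy_variance_def
    using sg variance_le_proxy_variance[OF assms(1) _ sq] by (rule Least_equality)
  with sg show ?thesis
    by (simp add: strictly_sub_gaussian_def)
qed

end
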